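(* Let $0<q<1$ and let $V_q$ be the $q$-integration operator on $W(\mathbb{D})$. Then its commutant is $$\{V_q\}'=\{\mathcal{D}_f:\ f\in W(\mathbb{D})\}.$$
   Context: $\mathbb{D}$ is the open unit disc in $\mathbb{C}$ and $0<q<1$ is fixed. $W(\mathbb{D})$ is the space of all functions $f(z)=\sum_{n=0}^\infty a_nz^n$ on $\mathbb{D}$ with $\|f\|_w=\sum_{n=0}^\infty|a_n|<\infty$. The $q$-derivative is $(D_qf)(z)=\frac{f(z)-f(qz)}{(1-q)z}$ (with its value at $z=0$ obtained by continuity), and the Jackson $q$-integral is $\int_0^z f(t)\,d_qt=z(1-q)\sum_{n=0}^\infty f(zq^n)q^n$. For $\xi\in\mathbb{C}$ the $q$-translation operator is given on $f(z)=\sum_{n\ge0}a_nz^n\in W(\mathbb{D})$ by $(\tau_q^\xi f)(z)=\sum_{n=0}^\infty a_n(z+q\xi)(z+q^2\xi)\cdots(z+q^n\xi)$ (the product being $1$ for $n=0$). The $q$-Duhamel product of $f,g\in W(\mathbb{D})$ is $$(f\star_q g)(z)=D_q\Big(\int_0^z(\tau_q^{-t}f)(z)\,g(t)\,d_qt\Big),$$ where $D_q$ acts on the function of $z$ in parentheses. The $q$-integration operator is $(V_qf)(z)=\int_0^zf(t)\,d_qt$ on $W(\mathbb{D})$, and for $f\in W(\mathbb{D})$ the $q$-Duhamel operator $\mathcal{D}_f$ on $W(\mathbb{D})$ is $\mathcal{D}_fg=f\star_qg$. The commutant $\{V_q\}'$ is the set of all bounded linear operators $A$ on $W(\mathbb{D})$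 with $AV_q=V_qA$. *)

theory Defs
  imports "HOL-Analysis.Analysis"
begin

text \<open>
  A function on the open unit disc is represented by a function on \<^typ>\<open>complex\<close>
  that vanishes off the disc.  Hence functions on the disc are equal iff their
  representatives are, and pointwise sums and multiples of representatives are again
  representatives.
\<close>

definition on_disc :: "(complex \<Rightarrow> complex) \<Rightarrow> complex \<Rightarrow> complex" where
  "on_disc h = (\<lambda>z. if z \<in> ball 0 1 then h z else 0)"

definition has_wiener_coeffs :: "(complex \<Rightarrow> complex) \<Rightarrow> (nat \<Rightarrow> complex) \<Rightarrow> bool" where
  "has_wiener_coeffs f a \<longleftrightarrow>
     summable (\<lambda>n. norm (a n)) \<and> f = on_disc (\<lambda>z. \<Sum>n. a n * z ^ n)"

definition wiener :: "(complex \<Rightarrow> complex) set" where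
  "wiener = {f. \<exists>a. has_wiener_coeffs f a}"

lemma has_wiener_coeffs_unique:
  assumes "has_wiener_coeffs f a" "has_wiener_coeffs f b"
  shows "a = b"
proof
  fix n
  have *: "(\<lambda>n. (a n - b n) * z ^ n) sums 0" if z: "norm z < 1" for z
  proof -
    have le: "norm (c n * z ^ n) \<le> norm (c n)" for c :: "nat \<Rightarrow> complex" and n
      using z by (simp add: norm_mult norm_power mult_left_le power_le_one)
    have s: "summable (\<lambda>n. c n * z ^ n)" if "summable (\<lambda>n. norm (c n))" for c :: "nat \<Rightarrow> complex"
      by (rule summable_comparison_test[OF _ that]) (use le in blast)
    have sa: "summable (\<lambda>n. a n * z ^ n)" and sb: "summable (\<lambda>n. b n * z ^ n)"
      using assms s unfolding has_wiener_coeffs_def by blast+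
    have "on_disc (\<lambda>z. \<Sum>n. a n * z ^ n) z = on_disc (\<lambda>z. \<Sum>n. b n * z ^ n) z"
      using assms unfolding has_wiener_coeffs_def by metis
    then have "(\<Sum>n. a n * z ^ n) = (\<Sum>n. b n * z ^ n)"
      using z by (simp add: on_disc_def)
    with sums_diff[OF summable_sums[OF sa] summable_sums[OF sb]] show ?thesis
      by (simp add: left_diff_distrib)
  qed
  have "a n - b n = 0" for n
  proof (induction n rule: less_induct)
    case (less n)
    have 1: "(\<lambda>k. (a (k + n) - b (k + n)) * z ^ k) sums 0" if z: "norm z < 1" "z \<noteq> 0" for z
    proof -
      have "(\<lambda>k. (a (k + n) - b (k + n)) * z ^ (k + n)) sums (0 - (\<Sum>i<n. (a i - b i) * z ^ i))"
        using sums_split_initial_segment[OF *[OF z(1)], of n] by simp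
      then have "(\<lambda>k. z ^ n * ((a (k + n) - b (k + n)) * z ^ k)) sums (z ^ n * 0)"
        using less by (simp add: power_add mult_ac)
      then show ?thesis using z(2) by (subst (asm) sums_mult_iff) auto
    qed
    have "((\<lambda>z::complex. 0) \<longlongrightarrow> a (0 + n) - b (0 + n)) (at 0)"
      by (rule powser_limit_0_strong[of 1 "\<lambda>k. a (k + n) - b (k + n)"]) (use 1 in auto)
    then show ?case by (simp add: tendsto_const_iff)
  qed
  then show "a n = b n" by simp
qed

definition wiener_coeff :: "(complex \<Rightarrow> complex) \<Rightarrow> nat \<Rightarrow> complex" where
  "wiener_coeff f = (THE a. has_wiener_coeffs f a)"

lemma wiener_coeff_eq: "has_wiener_coeffs f a \<Longrightarrow> wiener_coeff f = a"
  unfolding wiener_coeff_def by (blast intro: the_equality has_wiener_coeffs_unique)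

definition wiener_norm :: "(complex \<Rightarrow> complex) \<Rightarrow> real" where
  "wiener_norm f = (\<Sum>n. norm (wiener_coeff f n))"

definition q_deriv :: "real \<Rightarrow> (complex \<Rightarrow> complex) \<Rightarrow> complex \<Rightarrow> complex" where
  "q_deriv q F z =
     (let quot = (\<lambda>w. (F w - F (of_real q * w)) / ((1 - of_real q) * w))
      in if z = 0 then Lim (at 0) quot else quot z)"

definition jackson_integral :: "real \<Rightarrow> (complex \<Rightarrow> complex) \<Rightarrow> complex \<Rightarrow> complex" where
  "jackson_integral q f z =
     z * (1 - of_real q) * (\<Sum>n. f (z * of_real q ^ n) * of_real q ^ n)"

definition q_translation :: "real \<Rightarrow> complex \<Rightarrow> (complex \<Rightarrow> complex) \<Rightarrow> complex \<Rightarrow> complex" where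
  "q_translation q \<xi> f z =
     (\<Sum>n. wiener_coeff f n * (\<Prod>k=1..n. z + of_real q ^ k * \<xi>))"

definition q_duhamel :: "real \<Rightarrow> (complex \<Rightarrow> complex) \<Rightarrow> (complex \<Rightarrow> complex) \<Rightarrow> complex \<Rightarrow> complex" where
  "q_duhamel q f g =
     on_disc (q_deriv q (\<lambda>z. jackson_integral q (\<lambda>t. q_translation q (- t) f z * g t) z))"

text \<open>
  Operators on the space are extensional functions on \<^const>\<open>wiener\<close>, so that equality of
  operators is equality of functions.
\<close>

definition V_op :: "real \<Rightarrow> (complex \<Rightarrow> complex) \<Rightarrow> complex \<Rightarrow> complex" where
  "V_op q = (\<lambda>f\<in>wiener. on_disc (jackson_integral q f))"

definition duhamel_op :: "real \<Rightarrow> (complex \<Rightarrow> complex) \<Rightarrow> (complex \<Rightarrow> complex) \<Rightarrow> complex \<Rightarrow> complex" where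
  "duhamel_op q f = (\<lambda>g\<in>wiener. q_duhamel q f g)"

definition bounded_operators :: "((complex \<Rightarrow> complex) \<Rightarrow> complex \<Rightarrow> complex) set" where
  "bounded_operators = {A \<in> wiener \<rightarrow>\<^sub>E wiener.
     (\<forall>f\<in>wiener. \<forall>g\<in>wiener. A (\<lambda>z. f z + g z) = (\<lambda>z. A f z + A g z)) \<and>
     (\<forall>c. \<forall>f\<in>wiener. A (\<lambda>z. c * f z) = (\<lambda>z. c * A f z)) \<and>
     (\<exists>K. \<forall>f\<in>wiener. wiener_norm (A f) \<le> K * wiener_norm f)}"

definition commutant ::
  "((complex \<Rightarrow> complex) \<Rightarrow> complex \<Rightarrow> complex) \<Rightarrow> ((complex \<Rightarrow> complex) \<Rightarrow> complex \<Rightarrow> complex) set" where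
  "commutant T = {A \<in> bounded_operators. \<forall>f\<in>wiener. A (T f) = T (A f)}"

end

theory Submission imports Defs begin

text \<open>
  On coefficient sequences the operators become explicit.  With the q-integers
  \<open>[n] = 1 + q + \<dots> + q\<^sup>n\<^sup>-\<^sup>1\<close> and the q-factorials \<open>[n]!\<close>, the operator \<open>V\<^sub>q\<close> is the weighted
  shift \<open>z\<^sup>n \<mapsto> z\<^sup>n\<^sup>+\<^sup>1 / [n+1]\<close>, and the Duhamel product is determined by
  \<open>z\<^sup>n \<star> z\<^sup>m = ([n]! [m]! / [n+m]!) z\<^sup>n\<^sup>+\<^sup>m\<close>.  The second formula is a q-beta integral: at the node
  \<open>t = z q\<^sup>k\<close> the translate of \<open>z\<^sup>n\<close> is \<open>z\<^sup>n\<close> times the product of the numbers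
  \<open>1 - q\<^sup>k\<^sup>+\<^sup>j\<close> with \<open>1 \<le> j \<le> n\<close>, the sum over \<open>k\<close> is evaluated in \<open>q_beta_sums\<close>, and \<open>D\<^sub>q\<close> removes the
  surplus factor \<open>1 / [n+m+1]\<close>.  The result is \<open>q_duhamel_has_wiener_coeffs\<close>.

  The weights \<open>[n]! [m]! / [n+m]!\<close> are at most 1, so the Duhamel coefficients are dominated by those
  of a Cauchy product, and \<open>\<D>\<^sub>f\<close> is bounded with norm at most that of \<open>f\<close>.  Comparing
  coefficients shows that \<open>\<D>\<^sub>f\<close> commutes with \<open>V\<^sub>q\<close> (\<open>duhamel_op_in_commutant\<close>) and that
  \<open>\<D>\<^sub>f 1 = f\<close> (\<open>duhamel_op_one\<close>).

  Conversely, an operator in the commutant is determined by its value at the constant 1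
  (\<open>commutant_V_op_eqI\<close>): since \<open>z\<^sup>n\<^sup>+\<^sup>1 = [n+1] V\<^sub>q z\<^sup>n\<close>, commutation propagates the value at 1 to
  all monomials, and a bounded operator is determined by its values on monomials.  Hence every
  \<open>A\<close> in the commutant equals \<open>\<D>\<^sub>f\<close> with \<open>f = A 1\<close>, because both operators lie in the commutant
  and agree at 1.
\<close>

section \<open>Functions with absolutely summable Taylor coefficients\<close>

lemma summable_power_series_disc:
  fixes a :: "nat \<Rightarrow> complex"
  assumes "summable (\<lambda>n. norm (a n))" "norm z \<le> 1"
  shows "summable (\<lambda>n. norm (a n * z ^ n))"
  by (rule summable_comparison_test[OF _ assms(1)])
     (use assms(2) in \<open>auto simp: norm_mult norm_power mult_left_le power_le_one\<close>)

lemmas summable_power_series_disc' = summable_norm_cancel[OF summable_power_series_disc]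

lemma has_wiener_coeffs_sums:
  assumes "has_wiener_coeffs f a" "norm z < 1"
  shows "(\<lambda>n. a n * z ^ n) sums f z"
proof -
  have "summable (\<lambda>n. a n * z ^ n)"
    by (rule summable_power_series_disc') (use assms in \<open>simp_all add: has_wiener_coeffs_def\<close>)
  moreover have "f z = (\<Sum>n. a n * z ^ n)"
    using assms by (simp add: has_wiener_coeffs_def on_disc_def)
  ultimately show ?thesis using summable_sums by metis
qed

lemma has_wiener_coeffsI:
  assumes "summable (\<lambda>n. norm (a n))"
    and "\<And>z. norm z < 1 \<Longrightarrow> (\<lambda>n. a n * z ^ n) sums h z"
  shows "has_wiener_coeffs (on_disc h) a"
proof -
  have "on_disc h = on_disc (\<lambda>z. \<Sum>n. a n * z ^ n)"
    using assms(2) by (simp add: on_disc_def fun_eq_iff sums_iff)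
  with assms(1) show ?thesis by (simp add: has_wiener_coeffs_def)
qed

lemma has_wiener_coeffs_imp_wiener: "has_wiener_coeffs f a \<Longrightarrow> f \<in> wiener"
  by (auto simp: wiener_def)

lemma wienerE:
  assumes "f \<in> wiener"
  obtains "has_wiener_coeffs f (wiener_coeff f)" "summable (\<lambda>n. norm (wiener_coeff f n))"
proof -
  obtain a where a: "has_wiener_coeffs f a" using assms by (auto simp: wiener_def)
  then have "summable (\<lambda>n. norm (a n))" by (simp add: has_wiener_coeffs_def)
  with a show ?thesis using that by (simp add: wiener_coeff_eq[OF a])
qed

lemma has_wiener_coeffs_inj:
  "has_wiener_coeffs f a \<Longrightarrow> has_wiener_coeffs g a \<Longrightarrow> f = g"
  by (simp add: has_wiener_coeffs_def)

lemma has_wiener_coeffs_add: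
  assumes "has_wiener_coeffs f a" "has_wiener_coeffs g b"
  shows "has_wiener_coeffs (\<lambda>z. f z + g z) (\<lambda>n. a n + b n)"
proof -
  have "summable (\<lambda>n. norm (a n) + norm (b n))"
    using assms by (intro summable_add) (auto simp: has_wiener_coeffs_def)
  then have "summable (\<lambda>n. norm (a n + b n))"
    by (rule summable_comparison_test[rotated]) (auto intro: norm_triangle_ineq)
  then have "has_wiener_coeffs (on_disc (\<lambda>z. f z + g z)) (\<lambda>n. a n + b n)"
    by (rule has_wiener_coeffsI)
       (auto simp: algebra_simps intro!: sums_add has_wiener_coeffs_sums assms)
  moreover have "on_disc (\<lambda>z. f z + g z) = (\<lambda>z. f z + g z)"
    using assms by (auto simp: has_wiener_coeffs_def on_disc_def fun_eq_iff)
  ultimately show ?thesis by simp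
qed

lemma has_wiener_coeffs_scale:
  assumes "has_wiener_coeffs f a"
  shows "has_wiener_coeffs (\<lambda>z. c * f z) (\<lambda>n. c * a n)"
proof -
  have "summable (\<lambda>n. norm (c * a n))"
    using assms by (simp add: norm_mult has_wiener_coeffs_def summable_mult)
  then have "has_wiener_coeffs (on_disc (\<lambda>z. c * f z)) (\<lambda>n. c * a n)"
    by (rule has_wiener_coeffsI)
       (auto simp: mult.assoc intro!: sums_mult has_wiener_coeffs_sums assms)
  moreover have "on_disc (\<lambda>z. c * f z) = (\<lambda>z. c * f z)"
    using assms by (auto simp: has_wiener_coeffs_def on_disc_def fun_eq_iff)
  ultimately show ?thesis by simp
qed

lemma wiener_coeff_add:
  "f \<in> wiener \<Longrightarrow> g \<in> wiener \<Longrightarrow>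
   wiener_coeff (\<lambda>z. f z + g z) n = wiener_coeff f n + wiener_coeff g n"
  by (auto elim!: wienerE simp: wiener_coeff_eq[OF has_wiener_coeffs_add])

lemma wiener_coeff_scale:
  "f \<in> wiener \<Longrightarrow> wiener_coeff (\<lambda>z. c * f z) n = c * wiener_coeff f n"
  by (auto elim!: wienerE simp: wiener_coeff_eq[OF has_wiener_coeffs_scale])

lemma norm_wiener_coeff_le:
  assumes "f \<in> wiener" shows "norm (wiener_coeff f n) \<le> wiener_norm f"
proof -
  have "summable (\<lambda>n. norm (wiener_coeff f n))" using assms by (rule wienerE)
  from sum_le_suminf[OF this, of "{n}"] show ?thesis by (simp add: wiener_norm_def)
qed

definition wiener_fun :: "(nat \<Rightarrow> complex) \<Rightarrow> complex \<Rightarrow> complex" where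
  "wiener_fun a = on_disc (\<lambda>z. \<Sum>n. a n * z ^ n)"

lemma has_wiener_coeffs_wiener_fun:
  "summable (\<lambda>n. norm (a n)) \<Longrightarrow> has_wiener_coeffs (wiener_fun a) a"
  by (simp add: has_wiener_coeffs_def wiener_fun_def)

definition wiener_monomial :: "nat \<Rightarrow> complex \<Rightarrow> complex" where
  "wiener_monomial n = on_disc (\<lambda>z. z ^ n)"

lemma has_wiener_coeffs_monomial:
  "has_wiener_coeffs (wiener_monomial n) (\<lambda>k. if k = n then 1 else 0)"
  unfolding wiener_monomial_def
proof (rule has_wiener_coeffsI)
  show "summable (\<lambda>k. norm (if k = n then 1 else 0 :: complex))"
    by (rule summable_finite[of "{n}"]) auto
  show "(\<lambda>k. (if k = n then 1 else 0) * z ^ k) sums z ^ n" for z :: complex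
    using sums_single[of n "\<lambda>k. z ^ k"] by (simp add: if_distrib if_distribR cong: if_cong)
qed

lemma wiener_monomial_in_wiener: "wiener_monomial n \<in> wiener"
  using has_wiener_coeffs_monomial by (rule has_wiener_coeffs_imp_wiener)


section \<open>Bounded operators and monomials\<close>

lemma bounded_operatorsD:
  assumes "A \<in> bounded_operators"
  shows "f \<in> wiener \<Longrightarrow> A f \<in> wiener"
    and "f \<in> wiener \<Longrightarrow> g \<in> wiener \<Longrightarrow> A (\<lambda>z. f z + g z) = (\<lambda>z. A f z + A g z)"
    and "f \<in> wiener \<Longrightarrow> A (\<lambda>z. c * f z) = (\<lambda>z. c * A f z)"
  using assms by (auto simp: bounded_operators_def)

text \<open>
  The truncated power series converge to \<open>g\<close> in the Wiener norm, and each coefficient functional is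
  bounded by that norm; so boundedness alone carries the expansion of \<open>g\<close> through \<open>A\<close>.
\<close>

lemma bounded_operator_coeff_sums:
  assumes A: "A \<in> bounded_operators" and b: "has_wiener_coeffs g b"
  shows "(\<lambda>n. b n * wiener_coeff (A (wiener_monomial n)) i) sums wiener_coeff (A g) i"
proof -
  note D = bounded_operatorsD[OF A]
  obtain K where K: "\<And>f. f \<in> wiener \<Longrightarrow> wiener_norm (A f) \<le> K * wiener_norm f"
    using A unfolding bounded_operators_def by blast
  have sb: "summable (\<lambda>n. norm (b n))" using b by (simp add: has_wiener_coeffs_def)
  define T where "T N = wiener_fun (\<lambda>k. if k < N then b k else 0)" for N
  define R where "R N = wiener_fun (\<lambda>k. if k < N then 0 else b k)" for N
  have T: "has_wiener_coeffs (T N) (\<lambda>k. if k < N then b k else 0)" for N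
    unfolding T_def by (intro has_wiener_coeffs_wiener_fun summable_finite[of "{..<N}"]) auto
  have R: "has_wiener_coeffs (R N) (\<lambda>k. if k < N then 0 else b k)" for N
    unfolding R_def
    by (intro has_wiener_coeffs_wiener_fun summable_comparison_test[OF _ sb]) auto
  note W = has_wiener_coeffs_imp_wiener[OF T] has_wiener_coeffs_imp_wiener[OF R]
    wiener_monomial_in_wiener has_wiener_coeffs_imp_wiener[OF b]
  have partial: "wiener_coeff (A (T N)) i = (\<Sum>n<N. b n * wiener_coeff (A (wiener_monomial n)) i)" for N
  proof (induction N)
    case 0
    \<comment> \<open>\<open>T 0\<close> is the zero function, and \<open>A\<close> maps it to zero because it is 0 times itself.\<close>
    have "has_wiener_coeffs (\<lambda>z. 0 * T 0 z) (\<lambda>k. 0 * (if k < 0 then b k else 0))"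
      by (intro has_wiener_coeffs_scale T)
    then have "T 0 = (\<lambda>z. 0 * T 0 z)"
      by (intro has_wiener_coeffs_inj[OF T[of 0]]) simp
    then have "A (T 0) = (\<lambda>z. 0 * A (T 0) z)" using D(3)[OF W(1)] by metis
    then have "wiener_coeff (A (T 0)) i = 0 * wiener_coeff (A (T 0)) i"
      using wiener_coeff_scale[OF D(1)[OF W(1)]] by metis
    then show ?case by simp
  next
    case (Suc N)
    have mono: "has_wiener_coeffs (\<lambda>z. b N * wiener_monomial N z) (\<lambda>k. b N * (if k = N then 1 else 0))"
      by (intro has_wiener_coeffs_scale has_wiener_coeffs_monomial)
    have "(\<lambda>k. if k < Suc N then b k else 0) =
          (\<lambda>k. (if k < N then b k else 0) + b N * (if k = N then 1 else 0))"
      by (auto simp: fun_eq_iff less_Suc_eq)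
    then have "T (Suc N) = (\<lambda>z. T N z + b N * wiener_monomial N z)"
      using has_wiener_coeffs_inj[OF T[of "Suc N"]] has_wiener_coeffs_add[OF T[of N] mono] by simp
    then have "A (T (Suc N)) = (\<lambda>z. A (T N) z + b N * A (wiener_monomial N) z)"
      using D(2)[OF W(1) has_wiener_coeffs_imp_wiener[OF mono]] D(3)[OF W(3)] by metis
    then show ?case
      using Suc D(1)[OF W(1)[of N]] D(1)[OF W(3)[of N]]
      by (simp add: wiener_coeff_add wiener_coeff_scale bounded_operatorsD(3)[OF A, symmetric] D(1)
          has_wiener_coeffs_imp_wiener[OF mono] W(3))
  qed
  have split: "wiener_coeff (A g) i = wiener_coeff (A (T N)) i + wiener_coeff (A (R N)) i" for N
  proof -
    have "b = (\<lambda>k. (if k < N then b k else 0) + (if k < N then 0 else b k))"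
      by (auto simp: fun_eq_iff)
    then have "g = (\<lambda>z. T N z + R N z)"
      using has_wiener_coeffs_inj[OF b] has_wiener_coeffs_add[OF T[of N] R[of N]] by metis
    then have "A g = (\<lambda>z. A (T N) z + A (R N) z)" using D(2)[OF W(1,2)] by metis
    then show ?thesis by (simp add: wiener_coeff_add D(1) W)
  qed
  have "wiener_norm (R N) = (\<Sum>n. norm (b n)) - (\<Sum>n<N. norm (b n))" for N
  proof -
    have "(\<lambda>n. norm (b n) - (if n \<in> {..<N} then norm (b n) else 0)) sums
       ((\<Sum>n. norm (b n)) - (\<Sum>n<N. norm (b n)))"
      by (intro sums_diff summable_sums[OF sb] sums_If_finite_set) simp
    moreover have "norm (b n) - (if n \<in> {..<N} then norm (b n) else 0)
        = norm (if n < N then 0 else b n)" for n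
      by simp
    ultimately show ?thesis
      by (simp add: wiener_norm_def wiener_coeff_eq[OF R] sums_iff)
  qed
  moreover have "(\<lambda>N. \<Sum>n<N. norm (b n)) \<longlonglongrightarrow> (\<Sum>n. norm (b n))"
    using summable_LIMSEQ[OF sb] .
  ultimately have "(\<lambda>N. K * wiener_norm (R N)) \<longlonglongrightarrow> K * ((\<Sum>n. norm (b n)) - (\<Sum>n. norm (b n)))"
    by (simp only:) (intro tendsto_intros)
  then have lim: "(\<lambda>N. K * wiener_norm (R N)) \<longlonglongrightarrow> 0" by simp
  have "(\<lambda>N. wiener_coeff (A (R N)) i) \<longlonglongrightarrow> 0"
    by (rule Lim_null_comparison[OF always_eventually lim])
       (intro allI order_trans[OF norm_wiener_coeff_le[OF D(1)[OF W(2)]] K[OF W(2)]])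
  then have "(\<lambda>N. wiener_coeff (A g) i - wiener_coeff (A (R N)) i) \<longlonglongrightarrow> wiener_coeff (A g) i - 0"
    by (intro tendsto_intros)
  moreover have "wiener_coeff (A g) i - wiener_coeff (A (R N)) i
      = (\<Sum>n<N. b n * wiener_coeff (A (wiener_monomial n)) i)" for N
    using split[of N] partial[of N] by simp
  ultimately show ?thesis by (simp add: sums_def)
qed

lemma bounded_operators_eqI:
  assumes A: "A \<in> bounded_operators" and B: "B \<in> bounded_operators"
    and eq: "\<And>n. A (wiener_monomial n) = B (wiener_monomial n)"
  shows "A = B"
proof (rule PiE_ext[of A wiener "\<lambda>_. wiener" B])
  show "A \<in> wiener \<rightarrow>\<^sub>E wiener" "B \<in> wiener \<rightarrow>\<^sub>E wiener"
    using A B by (auto simp: bounded_operators_def)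
  fix g assume "g \<in> wiener"
  then have b: "has_wiener_coeffs g (wiener_coeff g)" by (rule wienerE)
  have "wiener_coeff (A g) = wiener_coeff (B g)"
    using bounded_operator_coeff_sums[OF A b] bounded_operator_coeff_sums[OF B b]
    by (auto simp: eq intro: sums_unique2)
  moreover have "A g \<in> wiener" "B g \<in> wiener"
    using bounded_operatorsD(1) A B \<open>g \<in> wiener\<close> by auto
  ultimately show "A g = B g" by (auto elim!: wienerE intro: has_wiener_coeffs_inj)
qed


section \<open>The q-analogue of the beta integral\<close>

definition qint :: "real \<Rightarrow> nat \<Rightarrow> real" where
  "qint q n = (\<Sum>i<n. q ^ i)"

definition qfact :: "real \<Rightarrow> nat \<Rightarrow> real" where
  "qfact q n = (\<Prod>k=1..n. qint q k)"

lemma qfact_0 [simp]: "qfact q 0 = 1"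
  by (simp add: qfact_def)

lemma qfact_Suc: "qfact q (Suc n) = qint q (Suc n) * qfact q n"
  by (simp add: qfact_def mult.commute)

lemma qint_eq: "q \<noteq> 1 \<Longrightarrow> qint q n = (1 - q ^ n) / (1 - q)"
  by (simp add: qint_def sum_gp_strict)

lemma qint_add: "qint q (m + n) = qint q m + q ^ m * qint q n"
  by (induction n) (simp_all add: qint_def algebra_simps power_add)

lemma qint_Suc_ge_1: "0 \<le> q \<Longrightarrow> 1 \<le> qint q (Suc n)"
  by (induction n) (simp_all add: qint_def add_increasing2)

lemma qint_Suc_pos: "0 \<le> q \<Longrightarrow> 0 < qint q (Suc n)"
  using qint_Suc_ge_1[of q n] by linarith

lemma qint_mono: "0 \<le> q \<Longrightarrow> m \<le> n \<Longrightarrow> qint q m \<le> qint q n"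
  unfolding qint_def by (intro sum_mono2) auto

lemma qfact_pos: "0 \<le> q \<Longrightarrow> 0 < qfact q n"
  by (induction n) (simp_all add: qfact_Suc qint_Suc_pos)

text \<open>
  The q-binomial coefficients are at least 1.  Each step of the induction multiplies the two sides by
  \<open>[n+1]\<close> and \<open>[m+n+1]\<close>, and q-integers increase.
\<close>

lemma qfact_mult_le:
  assumes "0 \<le> q" shows "qfact q m * qfact q n \<le> qfact q (m + n)"
proof (induction n)
  case (Suc n)
  have "qfact q m * qfact q (Suc n) = qint q (Suc n) * (qfact q m * qfact q n)"
    by (simp add: qfact_Suc)
  also have "\<dots> \<le> qint q (Suc (m + n)) * qfact q (m + n)"
    by (intro mult_mono Suc qint_mono assms mult_nonneg_nonneg less_imp_le[OF qfact_pos]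
        less_imp_le[OF qint_Suc_pos]) simp
  finally show ?case by (simp add: qfact_Suc)
qed simp

text \<open>
  Up to the factor \<open>1 - q\<close>, the sum is the Jackson integral over \<open>[0, 1]\<close> of \<open>x\<^sup>m\<close> times the product
  of the \<open>1 - q\<^sup>j x\<close>, so this is the q-analogue of \<open>B(m+1, n+1) = n! m! / (n+m+1)!\<close>.  Splitting the
  last factor as \<open>1 - q\<^sup>n\<^sup>+\<^sup>1 x\<close> reduces \<open>n+1\<close> to \<open>n\<close> at the exponents \<open>m\<close> and \<open>m+1\<close>; the case
  \<open>n = 0\<close> is a geometric series.
\<close>

lemma q_beta_sums:
  assumes q: "0 < q" "q < 1"
  shows "(\<lambda>k. (q ^ k) ^ Suc m * (\<Prod>j=1..n. 1 - q ^ (k + j))) sums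
           (qfact q n * qfact q m / (qfact q (Suc (n + m)) * (1 - q)))"
proof (induction n arbitrary: m)
  case 0
  have "(\<lambda>k. (q ^ Suc m) ^ k) sums (1 / (1 - q ^ Suc m))"
    by (rule geometric_sums) (use q power_less_one_iff[of q "Suc m"] in simp)
  moreover have "1 / (1 - q ^ Suc m) = qfact q 0 * qfact q m / (qfact q (Suc (0 + m)) * (1 - q))"
    using q qfact_pos[of q m] qint_eq[of q "Suc m"] by (simp add: qfact_Suc)
  moreover have "(q ^ k) ^ Suc m = (q ^ Suc m) ^ k" for k
    by (simp only: power_mult[symmetric] mult.commute)
  ultimately show ?case by simp
next
  case (Suc n)
  define P where "P k = (\<Prod>j=1..n. 1 - q ^ (k + j))" for k
  have "(\<lambda>k. (q ^ k) ^ Suc m * P k - q ^ Suc n * ((q ^ k) ^ Suc (Suc m) * P k)) sums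
     (qfact q n * qfact q m / (qfact q (Suc (n + m)) * (1 - q))
       - q ^ Suc n * (qfact q n * qfact q (Suc m) / (qfact q (Suc (n + Suc m)) * (1 - q))))"
    unfolding P_def by (intro sums_diff sums_mult Suc)
  moreover have "(q ^ k) ^ Suc m * (\<Prod>j=1..Suc n. 1 - q ^ (k + j)) =
      (q ^ k) ^ Suc m * P k - q ^ Suc n * ((q ^ k) ^ Suc (Suc m) * P k)" for k
    by (simp add: P_def algebra_simps power_add)
  moreover have "qfact q n * qfact q m / (qfact q (Suc (n + m)) * (1 - q))
       - q ^ Suc n * (qfact q n * qfact q (Suc m) / (qfact q (Suc (n + Suc m)) * (1 - q)))
     = qfact q (Suc n) * qfact q m / (qfact q (Suc (Suc n + m)) * (1 - q))"
  proof -
    \<comment> \<open>With \<open>w = u + q\<^sup>n\<^sup>+\<^sup>1 v\<close> the recurrence amounts to \<open>1 - q\<^sup>n\<^sup>+\<^sup>1 v / w = u / w\<close>.\<close>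
    define u where "u = qint q (Suc n)"
    define v where "v = qint q (Suc m)"
    define w where "w = qint q (Suc (Suc (n + m)))"
    have w: "w = u + q ^ Suc n * v"
      using qint_add[of q "Suc n" "Suc m"] by (simp add: u_def v_def w_def)
    have nz: "w \<noteq> 0" "qfact q (Suc (n + m)) \<noteq> 0" "1 - q \<noteq> 0"
      using q qint_Suc_pos[of q "Suc (n + m)"] qfact_pos[of q "Suc (n + m)"] by (auto simp: w_def)
    have "qfact q (Suc (n + Suc m)) = w * qfact q (Suc (n + m))"
      "qfact q (Suc (Suc n + m)) = w * qfact q (Suc (n + m))"
      "qfact q (Suc n) = u * qfact q n" "qfact q (Suc m) = v * qfact q m"
      by (simp_all add: qfact_Suc u_def v_def w_def)
    then show ?thesis
      using nz by (simp only:) (simp add: divide_simps, simp add: w algebra_simps)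
  qed
  ultimately show ?case by simp
qed


section \<open>Coefficients of the q-operators\<close>

lemma suminf_swap:
  fixes u :: "nat \<Rightarrow> nat \<Rightarrow> 'a::banach"
  assumes A: "summable A" and B: "summable B" and B0: "\<And>k. 0 \<le> B k"
    and le: "\<And>n k. norm (u n k) \<le> A n * B k"
  shows "(\<Sum>n. \<Sum>k. u n k) = (\<Sum>k. \<Sum>n. u n k)"
proof -
  have row: "summable (\<lambda>k. norm (u n k))" for n
    by (rule summable_comparison_test[OF _ summable_mult[OF B, of "A n"]]) (use le in auto)
  have col: "summable (\<lambda>n. norm (u n k))" for k
    by (rule summable_comparison_test[OF _ summable_mult2[OF A, of "B k"]]) (use le in auto)
  have eq: "infsum v UNIV = suminf v" if "summable (\<lambda>n. norm (v n))" for v :: "nat \<Rightarrow> 'b::banach"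
    by (intro infsumI norm_summable_imp_has_sum that summable_sums summable_norm_cancel[OF that])
  have row_le: "(\<Sum>k. norm (u n k)) \<le> A n * suminf B" for n
    using suminf_le[OF le row summable_mult[OF B]] by (simp add: suminf_mult B)
  have rows: "summable (\<lambda>n. \<Sum>k. norm (u n k))"
    by (rule summable_comparison_test[OF _ summable_mult2[OF A, of "suminf B"]])
       (use row_le row in \<open>auto simp: suminf_nonneg\<close>)
  have "(\<lambda>x. norm (case x of (n, k) \<Rightarrow> u n k)) summable_on UNIV \<times> UNIV"
    using row rows
    by (subst Infinite_Sum.abs_summable_on_Sigma_iff)
       (auto simp: eq suminf_nonneg intro!: norm_summable_imp_summable_on)
  then have *: "(\<lambda>(n, k). u n k) summable_on UNIV \<times> UNIV"
    by (rule Infinite_Sum.abs_summable_summable)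
  have rows': "summable (\<lambda>n. norm (\<Sum>k. u n k))"
    by (rule summable_comparison_test[OF _ rows]) (use summable_norm[OF row] in auto)
  have col_le: "(\<Sum>n. norm (u n k)) \<le> suminf A * B k" for k
    using suminf_le[OF le col summable_mult2[OF A]] by (simp add: suminf_mult2 A)
  have cols': "summable (\<lambda>k. norm (\<Sum>n. u n k))"
    by (rule summable_comparison_test[OF _ summable_mult[OF B, of "suminf A"]])
       (use order_trans[OF summable_norm[OF col] col_le] in auto)
  show ?thesis
    using infsum_swap_banach[OF *] row col rows' cols' by (simp add: eq)
qed

text \<open>
  The integrand is expanded in powers of \<open>z\<close> at each node \<open>z q\<^sup>k\<close> separately, with coefficients that
  may depend on \<open>k\<close>.  This covers the Duhamel integrand, where the translation parameter is tied to the
  integration variable.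
\<close>

lemma jackson_integral_power_series:
  assumes q: "0 < q" "q < 1" and z: "norm z \<le> 1"
    and A: "summable A" "\<And>N k. norm (e N k) \<le> A N"
    and h: "\<And>k. (\<lambda>N. e N k * z ^ N) sums h (z * of_real q ^ k)"
    and s: "\<And>N. (\<lambda>k. e N k * of_real q ^ k) sums s N"
  shows "jackson_integral q h z = z * (1 - of_real q) * (\<Sum>N. s N * z ^ N)"
proof -
  have "norm (e N k * of_real q ^ k * z ^ N) \<le> A N * q ^ k" for N k
  proof -
    have "norm (e N k) * q ^ k * norm z ^ N \<le> (A N * q ^ k) * 1"
      using A(2)[of N k] q z order_trans[OF norm_ge_zero A(2)[of N k]]
      by (intro mult_mono power_le_one) auto
    then show ?thesis using q by (simp add: norm_mult norm_power)
  qed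
  then have "(\<Sum>N. \<Sum>k. e N k * of_real q ^ k * z ^ N) = (\<Sum>k. \<Sum>N. e N k * of_real q ^ k * z ^ N)"
    using q by (intro suminf_swap[OF A(1), of "\<lambda>k. q ^ k"]) (auto intro: summable_geometric)
  moreover have "(\<Sum>k. e N k * of_real q ^ k * z ^ N) = s N * z ^ N" for N
    using sums_mult2[OF s] by (rule sums_unique[symmetric])
  moreover have "(\<Sum>N. e N k * of_real q ^ k * z ^ N) = h (z * of_real q ^ k) * of_real q ^ k" for k
    using sums_mult2[OF h[of k], of "of_real q ^ k"]
    by (intro sums_unique[symmetric]) (simp add: mult_ac)
  ultimately show ?thesis by (simp add: jackson_integral_def)
qed

lemma jackson_integral_has_wiener_coeffs:
  assumes q: "0 < q" "q < 1" and a: "has_wiener_coeffs f a"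
  shows "has_wiener_coeffs (on_disc (jackson_integral q f))
           (\<lambda>n. case n of 0 \<Rightarrow> 0 | Suc m \<Rightarrow> a m / of_real (qint q (Suc m)))"
    (is "has_wiener_coeffs _ ?c")
proof (rule has_wiener_coeffsI)
  have sa: "summable (\<lambda>n. norm (a n))" using a by (simp add: has_wiener_coeffs_def)
  have ge1: "1 \<le> qint q (Suc m)" for m using q qint_Suc_ge_1[of q] by simp
  have s: "summable (\<lambda>n. norm (?c (Suc n)))"
  proof (rule summable_comparison_test[OF _ sa], intro exI allI impI)
    fix n
    show "norm (norm (?c (Suc n))) \<le> norm (a n)"
      using ge1[of n] by (simp add: norm_divide divide_le_eq mult_left_le)
         (metis mult.right_neutral mult_left_mono norm_ge_zero)
  qed
  then show "summable (\<lambda>n. norm (?c n))" by (subst (asm) summable_Suc_iff)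
  fix z :: complex assume z: "norm z < 1"
  have zk: "norm (z * of_real q ^ k) < 1" for k
    using z q mult_right_le_one_le[of "norm z" "q ^ k"]
    by (simp add: norm_mult norm_power power_le_one)
  have h: "(\<lambda>N. (a N * (of_real q ^ k) ^ N) * z ^ N) sums f (z * of_real q ^ k)" for k
    using has_wiener_coeffs_sums[OF a zk[of k]] by (simp add: power_mult_distrib mult_ac)
  have le: "norm (a N * (of_real q ^ k) ^ N) \<le> norm (a N)" for N k
    using q by (auto simp: norm_mult norm_power power_le_one mult_left_le)
  have beta: "(\<lambda>k. a N * (of_real q ^ k) ^ N * of_real q ^ k) sums
      (a N * of_real (1 / (qint q (Suc N) * (1 - q))))" for N
  proof -
    have "(\<lambda>k. (q ^ k) ^ Suc N) sums (1 / (qint q (Suc N) * (1 - q)))"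
      using q_beta_sums[OF q, of N 0] qfact_pos[of q N] q by (simp add: qfact_Suc)
    from sums_mult[OF sums_of_real[OF this], of "a N"]
    have "(\<lambda>k. a N * of_real ((q ^ k) ^ Suc N)) sums
        (a N * of_real (1 / (qint q (Suc N) * (1 - q))))" .
    moreover have "a N * (of_real q ^ k) ^ N * of_real q ^ k = a N * of_real ((q ^ k) ^ Suc N)" for k
      by simp
    ultimately show ?thesis by (simp only:)
  qed
  have "jackson_integral q f z =
      z * (1 - of_real q) * (\<Sum>N. a N * of_real (1 / (qint q (Suc N) * (1 - q))) * z ^ N)"
    using z by (intro jackson_integral_power_series[OF q _ sa le h beta]) auto
  also have "\<dots> = z * (1 - of_real q) * (\<Sum>N. inverse (1 - of_real q) * (?c (Suc N) * z ^ N))"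
    by (simp add: divide_inverse mult_ac)
  also have "\<dots> = z * (\<Sum>N. ?c (Suc N) * z ^ N)"
  proof -
    have "summable (\<lambda>N. ?c (Suc N) * z ^ N)"
      using z by (intro summable_power_series_disc'[OF s]) auto
    moreover have "1 - complex_of_real q \<noteq> 0" using q by (simp add: complex_eq_iff)
    ultimately show ?thesis by (subst suminf_mult) simp_all
  qed
  finally have J: "jackson_integral q f z = z * (\<Sum>N. ?c (Suc N) * z ^ N)" .
  have "summable (\<lambda>N. ?c (Suc N) * z ^ N)"
    using z by (intro summable_power_series_disc'[OF s]) auto
  then have "(\<lambda>N. z * (?c (Suc N) * z ^ N)) sums jackson_integral q f z"
    unfolding J by (intro sums_mult summable_sums)
  then have "(\<lambda>N. ?c (Suc N) * z ^ Suc N) sums jackson_integral q f z"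
    by (simp add: mult_ac)
  then show "(\<lambda>N. ?c N * z ^ N) sums jackson_integral q f z"
    by (subst (asm) sums_Suc_iff) simp
qed

text \<open>
  Away from 0 this is \<open>D\<^sub>q z\<^sup>n\<^sup>+\<^sup>1 = [n+1] z\<^sup>n\<close> termwise.  At 0 the q-derivative is the limit of the
  difference quotients, which the same series identifies as its constant term.
\<close>

lemma q_deriv_power_series:
  fixes c :: "nat \<Rightarrow> complex"
  assumes q: "0 < q" "q < 1" and c: "summable (\<lambda>n. norm (c n))"
    and F: "\<And>z. norm z < 1 \<Longrightarrow> F z = z * (\<Sum>n. c n * z ^ n)"
    and z: "norm z < 1"
  shows "(\<lambda>n. of_real (qint q (Suc n)) * c n * z ^ n) sums q_deriv q F z"
proof -
  define quot where "quot w = (F w - F (of_real q * w)) / ((1 - of_real q) * w)" for w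
  have quot: "(\<lambda>n. of_real (qint q (Suc n)) * c n * w ^ n) sums quot w"
    if w: "norm w < 1" "w \<noteq> 0" for w
  proof -
    have qw: "norm (of_real q * w) < 1"
      using q w mult_strict_mono[of q 1 "norm w" 1] by (simp add: norm_mult)
    have s: "(\<lambda>n. c n * v ^ n) sums (\<Sum>n. c n * v ^ n)" if "norm v < 1" for v
      using that by (intro summable_sums summable_power_series_disc'[OF c]) auto
    have "(\<lambda>n. (w * (c n * w ^ n) - (of_real q * w) * (c n * (of_real q * w) ^ n)) / ((1 - of_real q) * w))
        sums quot w"
      unfolding quot_def F[OF w(1)] F[OF qw]
      by (intro sums_divide sums_diff sums_mult s w qw)
    moreover have "(w * (c n * w ^ n) - (of_real q * w) * (c n * (of_real q * w) ^ n)) / ((1 - of_real q) * w)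
       = of_real (qint q (Suc n)) * c n * w ^ n" for n
    proof -
      have "1 - complex_of_real q \<noteq> 0" using q by (simp add: complex_eq_iff)
      then show ?thesis using w(2) q
        by (simp add: qint_eq divide_simps power_mult_distrib algebra_simps)
    qed
    ultimately show ?thesis by simp
  qed
  show ?thesis
  proof (cases "z = 0")
    case False
    then show ?thesis using quot[OF z False] by (simp add: q_deriv_def quot_def)
  next
    case True
    have "(quot \<longlongrightarrow> of_real (qint q (Suc 0)) * c 0) (at 0)"
      by (rule powser_limit_0_strong[of 1]) (use quot in auto)
    then have "Lim (at 0) quot = of_real (qint q (Suc 0)) * c 0"
      by (intro tendsto_Lim) auto
    moreover have "q_deriv q F 0 = Lim (at 0) quot"
      by (simp add: q_deriv_def quot_def[abs_def])
    ultimately show ?thesis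
      using True powser_sums_zero[of "\<lambda>n. of_real (qint q (Suc n)) * c n"] by simp
  qed
qed

definition duhamel_coeff :: "real \<Rightarrow> (nat \<Rightarrow> complex) \<Rightarrow> (nat \<Rightarrow> complex) \<Rightarrow> nat \<Rightarrow> complex" where
  "duhamel_coeff q a b N =
     (\<Sum>n\<le>N. a n * b (N - n) * of_real (qfact q n * qfact q (N - n) / qfact q N))"

lemma norm_duhamel_coeff_le:
  assumes "0 \<le> q"
  shows "norm (duhamel_coeff q a b N) \<le> (\<Sum>n\<le>N. norm (a n) * norm (b (N - n)))"
  unfolding duhamel_coeff_def
proof (rule order_trans[OF norm_sum sum_mono])
  fix n assume "n \<in> {..N}"
  then have "\<bar>qfact q n * qfact q (N - n) / qfact q N\<bar> \<le> 1"
    using qfact_mult_le[OF assms, of n "N - n"] qfact_pos[OF assms]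
    by (simp add: abs_mult abs_of_pos)
  then show "norm (a n * b (N - n) * of_real (qfact q n * qfact q (N - n) / qfact q N))
      \<le> norm (a n) * norm (b (N - n))"
    unfolding norm_mult norm_of_real by (intro mult_left_le) auto
qed

lemma summable_duhamel_coeff:
  assumes q: "0 \<le> q" and a: "summable (\<lambda>n. norm (a n))" and b: "summable (\<lambda>n. norm (b n))"
  shows "summable (\<lambda>N. norm (duhamel_coeff q a b N))"
    and "(\<Sum>N. norm (duhamel_coeff q a b N)) \<le> (\<Sum>n. norm (a n)) * (\<Sum>n. norm (b n))"
proof -
  have C: "(\<lambda>N. \<Sum>n\<le>N. norm (a n) * norm (b (N - n))) sums ((\<Sum>n. norm (a n)) * (\<Sum>n. norm (b n)))"
    by (rule Cauchy_product_sums) (use a b in auto)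
  show *: "summable (\<lambda>N. norm (duhamel_coeff q a b N))"
    by (rule summable_comparison_test[OF _ sums_summable[OF C]])
       (use norm_duhamel_coeff_le[OF q] in auto)
  show "(\<Sum>N. norm (duhamel_coeff q a b N)) \<le> (\<Sum>n. norm (a n)) * (\<Sum>n. norm (b n))"
    using suminf_le[OF norm_duhamel_coeff_le[OF q] * sums_summable[OF C]] sums_unique[OF C] by simp
qed

text \<open>
  At a node the factor \<open>z - q\<^sup>j t\<close> becomes \<open>z (1 - q\<^sup>k\<^sup>+\<^sup>j)\<close>, so the translate of \<open>f\<close>, for fixed \<open>k\<close>, is
  again a power series in \<open>z\<close>.
\<close>

lemma q_translation_jackson_node:
  "q_translation q (- (z * of_real q ^ k)) f z =
     (\<Sum>n. (wiener_coeff f n * of_real (\<Prod>j=1..n. 1 - q ^ (k + j))) * z ^ n)"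
proof -
  have "(\<Prod>j=1..n. z + of_real q ^ j * - (z * of_real q ^ k)) =
      of_real (\<Prod>j=1..n. 1 - q ^ (k + j)) * z ^ n" for n
    by (induction n) (simp_all add: power_add algebra_simps)
  then show ?thesis by (simp add: q_translation_def mult_ac)
qed

text \<open>
  At each node the integrand is a product of two power series in \<open>z\<close>.  Its Cauchy coefficients are
  bounded uniformly in \<open>k\<close>, so the Jackson integral may be taken coefficientwise, where it is a
  finite combination of q-beta sums.
\<close>

lemma q_duhamel_has_wiener_coeffs:
  assumes q: "0 < q" "q < 1" and a: "has_wiener_coeffs f a" and b: "has_wiener_coeffs g b"
  shows "has_wiener_coeffs (q_duhamel q f g) (duhamel_coeff q a b)"
  unfolding q_duhamel_def
proof (rule has_wiener_coeffsI)
  have sa: "summable (\<lambda>n. norm (a n))" and sb: "summable (\<lambda>n. norm (b n))"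
    using a b by (auto simp: has_wiener_coeffs_def)
  show sd: "summable (\<lambda>N. norm (duhamel_coeff q a b N))"
    using q sa sb by (intro summable_duhamel_coeff) auto
  \<comment> \<open>The Jackson integral will be \<open>z\<close> times the series with these coefficients; the division by
    \<open>[N+1]\<close> is undone by \<open>D\<^sub>q\<close>.\<close>
  define c where "c N = duhamel_coeff q a b N / of_real (qint q (Suc N))" for N
  have ge1: "1 \<le> qint q (Suc m)" for m using q qint_Suc_ge_1[of q] by simp
  have sc: "summable (\<lambda>N. norm (c N))"
  proof (rule summable_comparison_test[OF _ sd], intro exI allI impI)
    fix n
    show "norm (norm (c n)) \<le> norm (duhamel_coeff q a b n)"
      using ge1[of n] mult_left_mono[OF ge1[of n] norm_ge_zero[of "duhamel_coeff q a b n"]]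
      by (simp add: c_def norm_divide divide_le_eq)
  qed
  define p where "p n k = (\<Prod>j=1..n. 1 - q ^ (k + j))" for n k
  have p: "0 \<le> p n k" "p n k \<le> 1" for n k
    unfolding p_def using q by (auto intro!: prod_nonneg prod_le_1 simp: power_le_one)
  define e where
    "e N k = (\<Sum>n\<le>N. (a n * of_real (p n k)) * (b (N - n) * (of_real q ^ k) ^ (N - n)))" for N k
  have eA: "norm (e N k) \<le> (\<Sum>n\<le>N. norm (a n) * norm (b (N - n)))" for N k
    unfolding e_def
  proof (rule order_trans[OF norm_sum sum_mono])
    fix n
    have "norm (a n) * p n k * (norm (b (N - n)) * (q ^ k) ^ (N - n))
        \<le> norm (a n) * 1 * (norm (b (N - n)) * 1)"
      using q p by (intro mult_mono mult_left_mono power_le_one mult_nonneg_nonneg) auto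
    then show "norm ((a n * of_real (p n k)) * (b (N - n) * (of_real q ^ k) ^ (N - n)))
        \<le> norm (a n) * norm (b (N - n))"
      using q p by (simp add: norm_mult norm_power)
  qed
  have es: "(\<lambda>k. e N k * of_real q ^ k) sums (c N / (1 - of_real q))" for N
  proof -
    define \<beta> where "\<beta> n = qfact q n * qfact q (N - n) / (qfact q (Suc N) * (1 - q))" for n
    have "(\<lambda>k. \<Sum>n\<le>N. a n * b (N - n) * of_real ((q ^ k) ^ Suc (N - n) * p n k)) sums
        (\<Sum>n\<le>N. a n * b (N - n) * of_real (\<beta> n))"
    proof (intro sums_sum sums_mult sums_of_real)
      fix n assume "n \<in> {..N}"
      then show "(\<lambda>k. (q ^ k) ^ Suc (N - n) * p n k) sums \<beta> n"
        using q_beta_sums[OF q, of "N - n" n] by (simp add: p_def \<beta>_def)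
    qed
    moreover have "(\<Sum>n\<le>N. a n * b (N - n) * of_real ((q ^ k) ^ Suc (N - n) * p n k)) =
        e N k * of_real q ^ k" for k
      by (simp add: e_def sum_distrib_left mult_ac)
    moreover have "(\<Sum>n\<le>N. a n * b (N - n) * of_real (\<beta> n)) = c N / (1 - of_real q)"
      by (simp add: c_def duhamel_coeff_def \<beta>_def sum_divide_distrib qfact_Suc mult_ac)
    ultimately show ?thesis by simp
  qed
  have q1: "1 - complex_of_real q \<noteq> 0" using q by (simp add: complex_eq_iff)
  fix z :: complex assume z: "norm z < 1"
  have J: "jackson_integral q (\<lambda>t. q_translation q (- t) f w * g t) w = w * (\<Sum>N. c N * w ^ N)"
    if w: "norm w < 1" for w
  proof -
    have wk: "norm (w * of_real q ^ k) < 1" for k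
      using w q mult_right_le_one_le[of "norm w" "q ^ k"]
      by (simp add: norm_mult norm_power power_le_one)
    have "(\<lambda>N. e N k * w ^ N) sums
        (q_translation q (- (w * of_real q ^ k)) f w * g (w * of_real q ^ k))" for k
    proof -
      have "summable (\<lambda>n. norm (a n * of_real (p n k)))"
        by (rule summable_comparison_test[OF _ sa])
           (use p in \<open>auto simp: norm_mult abs_of_nonneg intro!: mult_left_le\<close>)
      then have 1: "summable (\<lambda>n. norm (a n * of_real (p n k) * w ^ n))"
        using w by (intro summable_power_series_disc) auto
      have 2: "summable (\<lambda>n. norm (b n * (w * of_real q ^ k) ^ n))"
        using wk[of k] by (intro summable_power_series_disc sb) auto
      have "(\<lambda>N. \<Sum>n\<le>N. (a n * of_real (p n k) * w ^ n) * (b (N - n) * (w * of_real q ^ k) ^ (N - n)))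
          sums (q_translation q (- (w * of_real q ^ k)) f w * g (w * of_real q ^ k))"
        using Cauchy_product_sums[OF 1 2] sums_unique[OF has_wiener_coeffs_sums[OF b wk[of k]]]
        by (simp add: q_translation_jackson_node wiener_coeff_eq[OF a] p_def)
      moreover have "(\<Sum>n\<le>N. (a n * of_real (p n k) * w ^ n) * (b (N - n) * (w * of_real q ^ k) ^ (N - n)))
          = e N k * w ^ N" for N
        unfolding e_def sum_distrib_right
      proof (rule sum.cong[OF refl])
        fix n assume "n \<in> {..N}"
        then have "w ^ N = w ^ n * w ^ (N - n)" by (simp flip: power_add)
        then show "(a n * of_real (p n k) * w ^ n) * (b (N - n) * (w * of_real q ^ k) ^ (N - n)) =
            (a n * of_real (p n k)) * (b (N - n) * (of_real q ^ k) ^ (N - n)) * w ^ N"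
          by (simp add: power_mult_distrib mult_ac)
      qed
      ultimately show ?thesis by simp
    qed
    moreover have "summable (\<lambda>N. \<Sum>n\<le>N. norm (a n) * norm (b (N - n)))"
      by (rule summable_Cauchy_product) (use sa sb in auto)
    ultimately have "jackson_integral q (\<lambda>t. q_translation q (- t) f w * g t) w =
        w * (1 - of_real q) * (\<Sum>N. c N / (1 - of_real q) * w ^ N)"
      using w by (intro jackson_integral_power_series[OF q _ _ eA _ es]) auto
    also have "(\<Sum>N. c N / (1 - of_real q) * w ^ N) = (\<Sum>N. c N * w ^ N / (1 - of_real q))"
      by simp
    also have "\<dots> = (\<Sum>N. c N * w ^ N) / (1 - of_real q)"
      using w by (intro suminf_divide summable_power_series_disc'[OF sc]) auto
    finally show ?thesis using q1 by simp
  qed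
  have "of_real (qint q (Suc N)) * c N = duhamel_coeff q a b N" for N
    using ge1[of N] by (simp add: c_def)
  then show "(\<lambda>N. duhamel_coeff q a b N * z ^ N) sums
      q_deriv q (\<lambda>z. jackson_integral q (\<lambda>t. q_translation q (- t) f z * g t) z) z"
    using q_deriv_power_series[OF q sc J z] by simp
qed


section \<open>The commutant\<close>

lemma V_op_has_wiener_coeffs:
  assumes "0 < q" "q < 1" "has_wiener_coeffs f a"
  shows "has_wiener_coeffs (V_op q f)
           (\<lambda>n. case n of 0 \<Rightarrow> 0 | Suc m \<Rightarrow> a m / of_real (qint q (Suc m)))"
  using jackson_integral_has_wiener_coeffs[OF assms] has_wiener_coeffs_imp_wiener[OF assms(3)]
  by (simp add: V_op_def)

lemma duhamel_op_has_wiener_coeffs: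
  assumes "0 < q" "q < 1" "has_wiener_coeffs f a" "has_wiener_coeffs g b"
  shows "has_wiener_coeffs (duhamel_op q f g) (duhamel_coeff q a b)"
  using q_duhamel_has_wiener_coeffs[OF assms] has_wiener_coeffs_imp_wiener[OF assms(4)]
  by (simp add: duhamel_op_def)

lemma V_op_monomial:
  assumes q: "0 < q" "q < 1"
  shows "wiener_monomial (Suc n) = (\<lambda>z. of_real (qint q (Suc n)) * V_op q (wiener_monomial n) z)"
proof -
  have "qint q (Suc n) \<noteq> 0" using q qint_Suc_pos[of q n] by simp
  then have "(\<lambda>k. if k = Suc n then 1 else 0) = (\<lambda>k. of_real (qint q (Suc n)) *
      (case k of 0 \<Rightarrow> 0 | Suc m \<Rightarrow> (if m = n then 1 else 0) / of_real (qint q (Suc m))) :: complex)"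
    by (auto simp: fun_eq_iff split: nat.split)
  then show ?thesis
    using has_wiener_coeffs_inj[OF has_wiener_coeffs_monomial[of "Suc n"]]
      has_wiener_coeffs_scale[OF V_op_has_wiener_coeffs[OF q has_wiener_coeffs_monomial[of n]]]
    by simp
qed

text \<open>
  The constant 1 is a cyclic vector of \<open>V\<^sub>q\<close>: its images under the powers of \<open>V\<^sub>q\<close> are nonzero
  multiples of the monomials, whose span is dense.
\<close>

lemma commutant_V_op_eqI:
  assumes q: "0 < q" "q < 1"
    and A: "A \<in> commutant (V_op q)" and B: "B \<in> commutant (V_op q)"
    and one: "A (wiener_monomial 0) = B (wiener_monomial 0)"
  shows "A = B"
proof (rule bounded_operators_eqI)
  show bdd: "A \<in> bounded_operators" "B \<in> bounded_operators"
    using A B by (auto simp: commutant_def)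
  fix n
  show "A (wiener_monomial n) = B (wiener_monomial n)"
  proof (induction n)
    case (Suc n)
    have step: "C (wiener_monomial (Suc n)) =
        (\<lambda>z. of_real (qint q (Suc n)) * V_op q (C (wiener_monomial n)) z)"
      if C: "C \<in> commutant (V_op q)" for C
    proof -
      have "V_op q (wiener_monomial n) \<in> wiener"
        using V_op_has_wiener_coeffs[OF q has_wiener_coeffs_monomial]
        by (rule has_wiener_coeffs_imp_wiener)
      moreover have "C \<in> bounded_operators"
        "C (V_op q (wiener_monomial n)) = V_op q (C (wiener_monomial n))"
        using C wiener_monomial_in_wiener by (auto simp: commutant_def)
      ultimately show ?thesis
        by (subst V_op_monomial[OF q]) (simp add: bounded_operatorsD(3))
    qed
    show ?case by (simp add: step A B Suc)
  qed (fact one)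
qed

text \<open>
  Only the term \<open>n = N\<close> of the coefficient formula survives, with weight \<open>[N]! [0]! / [N]! = 1\<close>.
\<close>

lemma duhamel_op_one:
  assumes q: "0 < q" "q < 1" and f: "f \<in> wiener"
  shows "duhamel_op q f (wiener_monomial 0) = f"
proof -
  have "(\<Sum>n\<le>N. a n * (if N - n = 0 then 1 else 0) * of_real (qfact q n * qfact q (N - n) / qfact q N))
      = (\<Sum>n\<in>{N}. a n)" for a :: "nat \<Rightarrow> complex" and N
    using qfact_pos[of q N] q by (intro sum.mono_neutral_cong_right) auto
  then have "duhamel_coeff q a (\<lambda>k. if k = 0 then 1 else 0) = a" for a
    by (simp add: duhamel_coeff_def fun_eq_iff)
  moreover have a: "has_wiener_coeffs f (wiener_coeff f)" using f by (rule wienerE)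
  ultimately show ?thesis
    using duhamel_op_has_wiener_coeffs[OF q a has_wiener_coeffs_monomial[of 0]]
    by (intro has_wiener_coeffs_inj[OF _ a]) simp
qed

text \<open>
  Commutation with \<open>V\<^sub>q\<close> on the level of coefficients.  The factor \<open>1 / [M-n+1]\<close> from the shift turns
  \<open>[M-n+1]!\<close> into \<open>[M-n]!\<close>, while \<open>1 / [M+1]!\<close> supplies \<open>1 / [M+1]\<close>.
\<close>

lemma duhamel_coeff_shift:
  assumes q: "0 \<le> q"
  shows "duhamel_coeff q a (\<lambda>n. case n of 0 \<Rightarrow> 0 | Suc m \<Rightarrow> b m / of_real (qint q (Suc m))) =
    (\<lambda>N. case N of 0 \<Rightarrow> 0 | Suc M \<Rightarrow> duhamel_coeff q a b M / of_real (qint q (Suc M)))"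
proof
  fix N
  show "duhamel_coeff q a (\<lambda>n. case n of 0 \<Rightarrow> 0 | Suc m \<Rightarrow> b m / of_real (qint q (Suc m))) N =
    (case N of 0 \<Rightarrow> 0 | Suc M \<Rightarrow> duhamel_coeff q a b M / of_real (qint q (Suc M)))"
  proof (cases N)
    case (Suc M)
    have "a n * (b (M - n) / of_real (qint q (Suc (M - n)))) *
        of_real (qfact q n * qfact q (Suc (M - n)) / qfact q (Suc M)) =
      a n * b (M - n) * of_real (qfact q n * qfact q (M - n) / qfact q M) / of_real (qint q (Suc M))" for n
    proof -
      have "qint q (Suc (M - n)) \<noteq> 0" using qint_Suc_pos[OF q, of "M - n"] by simp
      moreover have "qfact q n * qfact q (Suc (M - n)) / qfact q (Suc M) =
          qint q (Suc (M - n)) * (qfact q n * qfact q (M - n) / qfact q M / qint q (Suc M))"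
        by (simp add: qfact_Suc mult_ac)
      ultimately show ?thesis
        by (simp only: of_real_mult of_real_divide) simp
    qed
    then show ?thesis
      unfolding Suc duhamel_coeff_def by (simp add: Suc_diff_le sum_divide_distrib)
  qed (simp add: duhamel_coeff_def)
qed

lemma duhamel_op_in_commutant:
  assumes q: "0 < q" "q < 1" and f: "f \<in> wiener"
  shows "duhamel_op q f \<in> commutant (V_op q)"
proof -
  let ?a = "wiener_coeff f"
  have a: "has_wiener_coeffs f ?a" using f by (rule wienerE)
  note D = duhamel_op_has_wiener_coeffs[OF q a]
  have DW: "duhamel_op q f g \<in> wiener" if "g \<in> wiener" for g
    using that by (auto elim!: wienerE intro: has_wiener_coeffs_imp_wiener D)
  have "duhamel_op q f \<in> wiener \<rightarrow>\<^sub>E wiener"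
    using DW by (auto simp: duhamel_op_def)
  moreover have "duhamel_op q f (\<lambda>z. g z + h z) = (\<lambda>z. duhamel_op q f g z + duhamel_op q f h z)"
    if gh: "g \<in> wiener" "h \<in> wiener" for g h
  proof -
    obtain b c where bc: "has_wiener_coeffs g b" "has_wiener_coeffs h c"
      using gh unfolding wiener_def by blast
    have "duhamel_coeff q ?a (\<lambda>n. b n + c n) = (\<lambda>n. duhamel_coeff q ?a b n + duhamel_coeff q ?a c n)"
      by (simp add: duhamel_coeff_def fun_eq_iff algebra_simps add_divide_distrib sum.distrib)
    then show ?thesis
      using has_wiener_coeffs_inj[OF D[OF has_wiener_coeffs_add[OF bc]]]
        has_wiener_coeffs_add[OF D[OF bc(1)] D[OF bc(2)]] by simp
  qed
  moreover have "duhamel_op q f (\<lambda>z. c * g z) = (\<lambda>z. c * duhamel_op q f g z)"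
    if g: "g \<in> wiener" for g c
  proof -
    obtain b where b: "has_wiener_coeffs g b"
      using g unfolding wiener_def by blast
    have "duhamel_coeff q ?a (\<lambda>n. c * b n) = (\<lambda>n. c * duhamel_coeff q ?a b n)"
      by (simp add: duhamel_coeff_def fun_eq_iff mult_ac sum_distrib_left)
    then show ?thesis
      using has_wiener_coeffs_inj[OF D[OF has_wiener_coeffs_scale[OF b]]]
        has_wiener_coeffs_scale[OF D[OF b]] by simp
  qed
  moreover have "wiener_norm (duhamel_op q f g) \<le> wiener_norm f * wiener_norm g"
    if "g \<in> wiener" for g
    using that
  proof (rule wienerE)
    assume b: "has_wiener_coeffs g (wiener_coeff g)" "summable (\<lambda>n. norm (wiener_coeff g n))"
    have "summable (\<lambda>n. norm (wiener_coeff f n))" using f by (rule wienerE)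
    then show ?thesis
      using summable_duhamel_coeff(2)[OF _ _ b(2)] q
      by (simp add: wiener_norm_def wiener_coeff_eq[OF D[OF b(1)]])
  qed
  moreover have "duhamel_op q f (V_op q g) = V_op q (duhamel_op q f g)" if g: "g \<in> wiener" for g
  proof -
    obtain b where b: "has_wiener_coeffs g b"
      using g unfolding wiener_def by blast
    show ?thesis
      using has_wiener_coeffs_inj[OF D[OF V_op_has_wiener_coeffs[OF q b]]]
        V_op_has_wiener_coeffs[OF q D[OF b]] duhamel_coeff_shift[of q ?a b] q by simp
  qed
  ultimately show ?thesis
    unfolding commutant_def bounded_operators_def by blast
qed

theorem theorem4p4:
  fixes q :: real
  assumes "0 < q" and "q < 1"
  shows "commutant (V_op q) = {duhamel_op q f | f. f \<in> wiener}"
proof (intro equalityI subsetI)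
  fix A assume A: "A \<in> commutant (V_op q)"
  define f where "f = A (wiener_monomial 0)"
  have f: "f \<in> wiener"
    using A wiener_monomial_in_wiener by (auto simp: f_def commutant_def bounded_operatorsD(1))
  have "A = duhamel_op q f"
    using assms A duhamel_op_in_commutant[OF assms f] duhamel_op_one[OF assms f]
    by (intro commutant_V_op_eqI[of q]) (simp_all add: f_def)
  then show "A \<in> {duhamel_op q f | f. f \<in> wiener}" using f by blast
next
  fix A assume "A \<in> {duhamel_op q f | f. f \<in> wiener}"
  then show "A \<in> commutant (V_op q)" using duhamel_op_in_commutant[OF assms] by blast
qed

end
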